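(* Let $d\in\mathbb N$, $\varepsilon,\delta,\kappa\in(0,\infty)$, $\mathcal K\in(\kappa,\infty)$, $\beta\in[0,1]$, $\mathcal L\in C^2(\mathbb R^d,\mathbb R)$, $\psi\in\mathbb R^d$ satisfy $(\nabla\mathcal L)(\psi)=0$ and $\kappa I_d\preceq(\operatorname{Hess}\mathcal L)(\psi)\preceq\mathcal K I_d$, and for every $\theta\in\mathbb R^d$ let $\mathbb M^\theta\colon\mathbb N_0\to\mathbb R^d$ and $\Theta^\theta\colon\mathbb N_0\to\mathbb R^d$ satisfy for all $n\in\mathbb N$ that $$\Theta_0^\theta=\theta,\qquad\mathbb M_0^\theta=0,\qquad\mathbb M_n^\theta=\beta\mathbb M_{n-1}^\theta+(1-\beta)\bigl[(\nabla\mathcal L)(\Theta_{n-1}^\theta)\bigr]^{\odot2},$$ $$\Theta_n^\theta=\Theta_{n-1}^\theta-\tfrac{2\varepsilon}{\kappa+\mathcal K}\bigl(\varepsilon\mathbf 1_d+(\mathbb M_n^\theta)^{\odot1/2}\bigr)^{\odot(-1)}\odot(\nabla\mathcal L)(\Theta_{n-1}^\theta).$$ Then there exist $\eta,c\in(0,\infty)$ such that for all $\theta\in\mathbb R^d$ with $\|\theta-\psi\|<\eta$ and all $n\in\mathbb N$ it holds that $$\|\Theta_n^\theta-\psi\|\le c\Bigl(\tfrac{\mathcal K-\kappa}{\mathcal K+\kappa}+\delta\Bigr)^n.$$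
   Context: $\mathbb N=\{1,2,\dots\}$, $\mathbb N_0=\mathbb N\cup\{0\}$; $\|\cdot\|$ is the Euclidean norm; $I_d$ is the identity matrix and $\mathbf 1_d=(1,\dots,1)\in\mathbb R^d$. $A\preceq B$ means $\langle v,Av\rangle\le\langle v,Bv\rangle$ for all $v$. For $x,y\in\mathbb R^d$, $x\odot y=(x_1y_1,\dots,x_dy_d)$ and $x^{\odot r}=(x_1^r,\dots,x_d^r)$ (componentwise power, whenever defined). *)

theory Defs
  imports "HOL-Analysis.Analysis"
begin

definition grad :: "(real ^ 'n \<Rightarrow> real) \<Rightarrow> real ^ 'n \<Rightarrow> real ^ 'n" where
  "grad f x = (\<chi> i. frechet_derivative f (at x) (axis i 1))"

lemma GDERIV_grad:
  assumes "f differentiable (at x)"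
  shows "GDERIV f x :> grad f x"
proof -
  have D: "(f has_derivative frechet_derivative f (at x)) (at x)"
    using assms frechet_derivative_works by blast
  then have lin: "linear (frechet_derivative f (at x))"
    by (rule has_derivative_linear)
  have "frechet_derivative f (at x) h = h \<bullet> grad f x" for h
  proof -
    have "frechet_derivative f (at x) h
        = frechet_derivative f (at x) (\<Sum>i\<in>UNIV. (h $ i) *\<^sub>R axis i 1)"
      using basis_expansion[of h] by (simp add: scalar_mult_eq_scaleR)
    also have "\<dots> = (\<Sum>i\<in>UNIV. (h $ i) *\<^sub>R frechet_derivative f (at x) (axis i 1))"
      by (simp add: linear_sum[OF lin] linear_scale[OF lin])
    also have "\<dots> = h \<bullet> grad f x"
      by (simp add: inner_vec_def grad_def)
    finally show ?thesis .
  qed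
  then have "frechet_derivative f (at x) = (\<lambda>h. h \<bullet> grad f x)" by blast
  then show ?thesis using D by (simp add: gderiv_def)
qed

text \<open>The \<open>(i, j)\<close> entry is \<open>\<partial>\<^sub>j \<partial>\<^sub>i f\<close>; the order is immaterial for functions of class \<open>C\<^sup>2\<close>.\<close>

definition Hess :: "(real ^ 'n \<Rightarrow> real) \<Rightarrow> real ^ 'n \<Rightarrow> real ^ 'n ^ 'n" where
  "Hess f x = jacobian (grad f) (at x)"

definition C2 :: "(real ^ 'n \<Rightarrow> real) \<Rightarrow> bool" where
  "C2 f \<longleftrightarrow> f differentiable_on UNIV \<and> grad f differentiable_on UNIV \<and> continuous_on UNIV (Hess f)"

definition loewner_le :: "real ^ 'n ^ 'n \<Rightarrow> real ^ 'n ^ 'n \<Rightarrow> bool" (infix "\<preceq>" 50) where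
  "A \<preceq> B \<longleftrightarrow> (\<forall>v. v \<bullet> (A *v v) \<le> v \<bullet> (B *v v))"

text \<open>
  The library's multiplication, unit and powers on \<open>real ^ 'n\<close> are componentwise, so \<open>x * y\<close> is
  the Hadamard product, \<open>1\<close> is the all-ones vector and \<open>x\<^sup>2\<close> is the componentwise square.
\<close>

lemma vec_power_nth: "((x :: real ^ 'n) ^ k) $ i = (x $ i) ^ k"
  by (induction k) auto

text \<open>
  The componentwise powers with exponents \<open>1/2\<close> and \<open>-1\<close>. The square root is only applied to vectors
  with nonnegative entries and the inverse only to vectors with positive entries.
\<close>

definition sqrt_vec :: "real ^ 'n \<Rightarrow> real ^ 'n" where
  "sqrt_vec x = (\<chi> i. sqrt (x $ i))"

definition inv_vec :: "real ^ 'n \<Rightarrow> real ^ 'n" where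
  "inv_vec x = (\<chi> i. inverse (x $ i))"

end

theory Submission
  imports Defs
begin

text \<open>
  By symmetry of the Hessian \<open>H\<close> at \<open>\<psi>\<close>, the bounds on its quadratic form say that
  \<open>I - 2 / (\<kappa> + K) H\<close> has operator norm at most \<open>(K - \<kappa>) / (K + \<kappa>)\<close>. Near \<open>\<psi>\<close> the gradients are
  small, hence so is every \<open>M\<close>, so the preconditioner \<open>\<epsilon> (\<epsilon> + sqrt M)\<^sup>-\<^sup>1\<close> is a small
  perturbation of the identity and each step contracts the distance to \<open>\<psi>\<close> by a factor at most
  \<open>(K - \<kappa>) / (K + \<kappa>) + \<delta>\<close>. Capping this factor at \<open>1\<close> keeps the iterates in the initial ball.
\<close>

text \<open>The mean value theorem in direction \<open>u\<close> turns the second difference into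
  \<open>h *\<^sub>R u\<close> paired with a difference of two gradients near \<open>x\<close>.
  Linearizing both gradients at \<open>x\<close> leaves \<open>h *\<^sub>R D v\<close> and an error
  of order \<open>h\<close>.\<close>

lemma second_difference_estimate:
  fixes f :: "'a::real_inner \<Rightarrow> real"
  assumes f: "\<And>y. GDERIV f y :> g y"
    and g: "(g has_derivative D) (at x)"
    and "e > 0"
  obtains d where "d > 0"
    "\<And>h. 0 < h \<Longrightarrow> h < d \<Longrightarrow>
      \<bar>f (x + h *\<^sub>R u + h *\<^sub>R v) - f (x + h *\<^sub>R u) - f (x + h *\<^sub>R v) + f x - h\<^sup>2 * (u \<bullet> D v)\<bar> \<le> e * h\<^sup>2"
proof -
  \<comment> \<open>\<open>h * N\<close> bounds both displacements from \<open>x\<close> as well as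
    \<open>norm (h *\<^sub>R u)\<close>; the summand 1 keeps \<open>N\<close> positive when
    \<open>u = v = 0\<close>. Two linearization errors \<open>e' * (h * N)\<close>, multiplied by
    \<open>h * N\<close>, then add up to exactly \<open>e * h\<^sup>2\<close>.\<close>
  define N where "N = norm u + norm v + 1"
  define e' where "e' = e / (2 * N\<^sup>2)"
  have N: "N > 0" by (simp add: N_def add_nonneg_pos)
  have e': "e' > 0" using N \<open>e > 0\<close> by (simp add: e'_def)
  have lin: "linear D" using g by (rule has_derivative_linear)
  from g e' obtain d0 where d0: "d0 > 0"
    and approx: "\<And>y. norm (y - x) < d0 \<Longrightarrow> norm (g y - g x - D (y - x)) \<le> e' * norm (y - x)"
    unfolding has_derivative_at_alt by blast
  have "\<bar>f (x + h *\<^sub>R u + h *\<^sub>R v) - f (x + h *\<^sub>R u) - f (x + h *\<^sub>R v) + f x - h\<^sup>2 * (u \<bullet> D v)\<bar> \<le> e * h\<^sup>2"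
    if h: "0 < h" "h < d0 / N" for h
  proof -
    define \<phi> where "\<phi> t = f (x + t *\<^sub>R (h *\<^sub>R u) + h *\<^sub>R v) - f (x + t *\<^sub>R (h *\<^sub>R u))" for t
    define \<phi>' where "\<phi>' t = (h *\<^sub>R u) \<bullet> (g (x + t *\<^sub>R (h *\<^sub>R u) + h *\<^sub>R v) - g (x + t *\<^sub>R (h *\<^sub>R u)))" for t
    have hd: "h * N < d0" using h N by (simp add: pos_less_divide_eq)
    have deriv: "(\<phi> has_real_derivative \<phi>' t) (at t)" for t
    proof -
      have fd: "(f has_derivative (\<lambda>k. k \<bullet> g y)) (at y)" for y
        using f[of y] by (simp add: gderiv_def)
      have 1: "((\<lambda>t. f (x + t *\<^sub>R (h *\<^sub>R u) + h *\<^sub>R v)) has_derivative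
            (\<lambda>s. (s *\<^sub>R (h *\<^sub>R u)) \<bullet> g (x + t *\<^sub>R (h *\<^sub>R u) + h *\<^sub>R v))) (at t)"
        by (rule has_derivative_compose[OF _ fd]) (auto intro!: derivative_eq_intros)
      have 2: "((\<lambda>t. f (x + t *\<^sub>R (h *\<^sub>R u))) has_derivative
            (\<lambda>s. (s *\<^sub>R (h *\<^sub>R u)) \<bullet> g (x + t *\<^sub>R (h *\<^sub>R u)))) (at t)"
        by (rule has_derivative_compose[OF _ fd]) (auto intro!: derivative_eq_intros)
      show ?thesis
        unfolding has_field_derivative_def \<phi>_def \<phi>'_def
        by (rule has_derivative_eq_rhs[OF has_derivative_diff[OF 1 2]])
          (auto simp: fun_eq_iff inner_diff_right algebra_simps)
    qed
    \<comment> \<open>The increment of \<open>\<phi>\<close> over the unit interval is the second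
      difference.\<close>
    obtain \<xi> where \<xi>: "0 < \<xi>" "\<xi> < 1" "\<phi> 1 - \<phi> 0 = \<phi>' \<xi>"
      using MVT2[of 0 1 \<phi> \<phi>'] deriv by auto
    define w1 where "w1 = \<xi> *\<^sub>R (h *\<^sub>R u) + h *\<^sub>R v"
    define w2 where "w2 = \<xi> *\<^sub>R (h *\<^sub>R u)"
    have n2: "norm w2 \<le> h * norm u"
      using \<xi> h by (simp add: w2_def mult_left_le_one_le)
    have "norm w1 \<le> norm w2 + h * norm v"
      unfolding w1_def w2_def[symmetric] using norm_triangle_ineq[of w2 "h *\<^sub>R v"] h by simp
    moreover have "h * N = h * norm u + h * norm v + h" by (simp add: N_def algebra_simps)
    moreover have "0 \<le> h * norm v" using h by simp
    ultimately have w1: "norm w1 \<le> h * N" and w2: "norm w2 \<le> h * N"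
      using n2 h(1) by linarith+
    have a1: "norm (g (x + w1) - g x - D w1) \<le> e' * (h * N)"
      using approx[of "x + w1"] w1 hd e' by (auto intro: order_trans mult_left_mono)
    have a2: "norm (g (x + w2) - g x - D w2) \<le> e' * (h * N)"
      using approx[of "x + w2"] w2 hd e' by (auto intro: order_trans mult_left_mono)
    \<comment> \<open>The unknown intermediate point \<open>\<xi>\<close> cancels here, since
      \<open>w1\<close> and \<open>w2\<close> differ by \<open>h *\<^sub>R v\<close>.\<close>
    have "D w1 - D w2 = h *\<^sub>R D v"
      by (simp add: w1_def w2_def linear_add[OF lin] linear_scale[OF lin])
    then have split: "g (x + w1) - g (x + w2) - h *\<^sub>R D v
        = (g (x + w1) - g x - D w1) - (g (x + w2) - g x - D w2)"
      by (simp add: algebra_simps)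
    have a3: "norm (g (x + w1) - g (x + w2) - h *\<^sub>R D v) \<le> 2 * e' * (h * N)"
      using norm_triangle_ineq4[of "g (x + w1) - g x - D w1" "g (x + w2) - g x - D w2"] a1 a2
      unfolding split by linarith
    have "f (x + h *\<^sub>R u + h *\<^sub>R v) - f (x + h *\<^sub>R u) - f (x + h *\<^sub>R v) + f x = \<phi>' \<xi>"
      using \<xi>(3) by (simp add: \<phi>_def)
    also have "\<dots> - h\<^sup>2 * (u \<bullet> D v) = (h *\<^sub>R u) \<bullet> (g (x + w1) - g (x + w2) - h *\<^sub>R D v)"
      by (simp add: \<phi>'_def w1_def w2_def inner_diff_right power2_eq_square algebra_simps)
    also have "\<bar>\<dots>\<bar> \<le> norm (h *\<^sub>R u) * norm (g (x + w1) - g (x + w2) - h *\<^sub>R D v)"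
      by (rule Cauchy_Schwarz_ineq2)
    also have "\<dots> \<le> (h * N) * (2 * e' * (h * N))"
      using h N e' a3 by (intro mult_mono) (auto simp: N_def)
    also have "\<dots> = e * h\<^sup>2"
      using N by (simp add: e'_def power2_eq_square)
    finally show ?thesis .
  qed
  then show ?thesis using that[of "d0 / N"] d0 N by simp
qed

text \<open>The second difference does not change when \<open>u\<close> and \<open>v\<close> are
  swapped. Divided by \<open>h\<^sup>2\<close> for one small \<open>h\<close>, it lies within
  \<open>e / 2\<close> of both sides, so these differ by at most \<open>e\<close>.\<close>

lemma gradient_derivative_symmetric:
  fixes f :: "'a::real_inner \<Rightarrow> real"
  assumes f: "\<And>y. GDERIV f y :> g y"
    and g: "(g has_derivative D) (at x)"
  shows "u \<bullet> D v = v \<bullet> D u"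
proof -
  have "\<bar>u \<bullet> D v - v \<bullet> D u\<bar> \<le> 0 + e" if "e > 0" for e
  proof -
    have e2: "e / 2 > 0" using that by simp
    obtain d1 where d1: "d1 > 0"
      "\<And>h. 0 < h \<Longrightarrow> h < d1 \<Longrightarrow>
        \<bar>f (x + h *\<^sub>R u + h *\<^sub>R v) - f (x + h *\<^sub>R u) - f (x + h *\<^sub>R v) + f x - h\<^sup>2 * (u \<bullet> D v)\<bar> \<le> e / 2 * h\<^sup>2"
      using second_difference_estimate[OF f g e2, of u v] by metis
    obtain d2 where d2: "d2 > 0"
      "\<And>h. 0 < h \<Longrightarrow> h < d2 \<Longrightarrow>
        \<bar>f (x + h *\<^sub>R v + h *\<^sub>R u) - f (x + h *\<^sub>R v) - f (x + h *\<^sub>R u) + f x - h\<^sup>2 * (v \<bullet> D u)\<bar> \<le> e / 2 * h\<^sup>2"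
      using second_difference_estimate[OF f g e2, of v u] by metis
    obtain h where h: "0 < h" "h < d1" "h < d2"
      using field_lbound_gt_zero[OF d1(1) d2(1)] by blast
    have "x + h *\<^sub>R v + h *\<^sub>R u = x + h *\<^sub>R u + h *\<^sub>R v" by (simp add: algebra_simps)
    note swapped = d2(2)[OF h(1,3), unfolded this]
    have "\<bar>h\<^sup>2 * (u \<bullet> D v) - h\<^sup>2 * (v \<bullet> D u)\<bar> \<le> e * h\<^sup>2"
      using d1(2)[OF h(1,2)] swapped by argo
    then have "h\<^sup>2 * \<bar>u \<bullet> D v - v \<bullet> D u\<bar> \<le> h\<^sup>2 * e"
      unfolding right_diff_distrib[symmetric] abs_mult by (simp add: mult.commute)
    then show ?thesis using h by simp
  qed
  then have "\<bar>u \<bullet> D v - v \<bullet> D u\<bar> \<le> 0" by (rule field_le_epsilon)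
  then show ?thesis by simp
qed

text \<open>For symmetric \<open>A\<close>, polarization expresses \<open>x \<bullet> A v\<close> by
  the quadratic form at \<open>x + v\<close> and \<open>x - v\<close>, and the parallelogram law
  sums the two bounds. Taking \<open>x\<close> parallel to \<open>A v\<close> recovers the norm of
  \<open>A v\<close>.\<close>

lemma symmetric_norm_bound:
  fixes A :: "'a::real_inner \<Rightarrow> 'a"
  assumes lin: "linear A"
    and sym: "\<And>u v. u \<bullet> A v = v \<bullet> A u"
    and q: "\<And>v. \<bar>v \<bullet> A v\<bar> \<le> q * (norm v)\<^sup>2"
  shows "norm (A v) \<le> q * norm v"
proof (cases "A v = 0")
  case True
  then show ?thesis
    \<comment> \<open>It remains to show \<open>0 \<le> q * norm v\<close>. The sign of
      \<open>q\<close> is not assumed; for nonzero \<open>v\<close> it follows from the form bound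
      at \<open>v\<close>.\<close>
    using q[of v] by (cases "v = 0") (auto simp: zero_le_mult_iff)
next
  case False
  then have v: "v \<noteq> 0" using linear_0[OF lin] by auto
  \<comment> \<open>Polarize at two vectors of equal norm.\<close>
  define x where "x = (norm v / norm (A v)) *\<^sub>R A v"
  have nx: "norm x = norm v" using False by (simp add: x_def)
  have "4 * (x \<bullet> A v) = (x + v) \<bullet> A (x + v) - (x - v) \<bullet> A (x - v)"
    using sym[of x v]
    by (simp add: linear_add[OF lin] linear_diff[OF lin] inner_add_left inner_add_right
        inner_diff_left inner_diff_right)
  also have "\<dots> \<le> q * (norm (x + v))\<^sup>2 + q * (norm (x - v))\<^sup>2"
    using q[of "x + v"] q[of "x - v"] by linarith
  also have "\<dots> = 4 * (q * (norm v)\<^sup>2)"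
  proof -
    have "(norm (x + v))\<^sup>2 + (norm (x - v))\<^sup>2 = 2 * (norm x)\<^sup>2 + 2 * (norm v)\<^sup>2"
      by (simp add: power2_norm_eq_inner inner_add_left inner_add_right
          inner_diff_left inner_diff_right inner_commute)
    then show ?thesis unfolding distrib_left[symmetric] nx by simp
  qed
  finally have "x \<bullet> A v \<le> q * (norm v)\<^sup>2" by simp
  moreover have "x \<bullet> A v = norm v * norm (A v)"
    using False by (simp add: x_def power2_norm_eq_inner[symmetric] power2_eq_square)
  ultimately have "norm v * norm (A v) \<le> norm v * (q * norm v)"
    by (simp add: power2_eq_square algebra_simps)
  then show ?thesis using v by simp
qed

text \<open>The step size \<open>2 / (\<kappa> + K)\<close> is the reciprocal of the midpoint of the
  interval from \<open>\<kappa>\<close> to \<open>K\<close>. It centres the quadratic form of the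
  iteration map at zero, so both bounds on \<open>H\<close> yield the same absolute bound, which
  symmetry turns into a norm bound.\<close>

lemma richardson_contraction:
  fixes H :: "real ^ 'd ^ 'd"
  assumes "\<kappa> > 0" "K > \<kappa>"
    and sym: "\<And>u v. u \<bullet> (H *v v) = v \<bullet> (H *v u)"
    and lo: "\<kappa> *\<^sub>R mat 1 \<preceq> H" and hi: "H \<preceq> K *\<^sub>R mat 1"
  shows "norm (v - (2 / (\<kappa> + K)) *\<^sub>R (H *v v)) \<le> (K - \<kappa>) / (K + \<kappa>) * norm v"
proof (rule symmetric_norm_bound)
  show "linear (\<lambda>v. v - (2 / (\<kappa> + K)) *\<^sub>R (H *v v))"
    by (intro linear_compose_sub linear_compose_scale_right linear_ident matrix_vector_mul_linear)
  show "u \<bullet> (v - (2 / (\<kappa> + K)) *\<^sub>R (H *v v)) = v \<bullet> (u - (2 / (\<kappa> + K)) *\<^sub>R (H *v u))" for u v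
    using sym[of u v] by (simp add: inner_diff_right inner_commute)
  show "\<bar>v \<bullet> (v - (2 / (\<kappa> + K)) *\<^sub>R (H *v v))\<bar> \<le> (K - \<kappa>) / (K + \<kappa>) * (norm v)\<^sup>2" for v
  proof -
    have "\<kappa> * (norm v)\<^sup>2 \<le> v \<bullet> (H *v v)" "v \<bullet> (H *v v) \<le> K * (norm v)\<^sup>2"
      using lo hi
      by (simp_all add: loewner_le_def scaleR_matrix_vector_assoc[symmetric] power2_norm_eq_inner)
    then have "\<bar>(\<kappa> + K) * (norm v)\<^sup>2 - 2 * (v \<bullet> (H *v v))\<bar> \<le> (K - \<kappa>) * (norm v)\<^sup>2"
      by (simp add: abs_le_iff algebra_simps)
    moreover have "v \<bullet> (v - (2 / (\<kappa> + K)) *\<^sub>R (H *v v))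
        = ((\<kappa> + K) * (norm v)\<^sup>2 - 2 * (v \<bullet> (H *v v))) / (\<kappa> + K)"
      using assms(1,2) by (simp add: inner_diff_right power2_norm_eq_inner field_simps)
    ultimately show ?thesis
      using assms(1,2) by (simp add: abs_divide divide_right_mono add.commute)
  qed
qed

text \<open>In component \<open>i\<close> the error is \<open>g $ i\<close> times
  \<open>r / (\<epsilon> + r)\<close> with \<open>r = sqrt (m $ i)\<close>, and this factor is at
  most \<open>s / \<epsilon>\<close>. Stating the bound on \<open>m\<close> as a square fits its
  use, where \<open>m\<close> averages squared gradient entries.\<close>

lemma preconditioner_error:
  fixes m g :: "real ^ 'd"
  assumes "\<epsilon> > 0" and m: "\<And>i. 0 \<le> m $ i" "\<And>i. m $ i \<le> s\<^sup>2" and "s \<ge> 0"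
  shows "norm (g - \<epsilon> *\<^sub>R (inv_vec (\<epsilon> *\<^sub>R 1 + sqrt_vec m) * g)) \<le> s / \<epsilon> * norm g"
proof -
  have "norm ((g - \<epsilon> *\<^sub>R (inv_vec (\<epsilon> *\<^sub>R 1 + sqrt_vec m) * g)) $ i) \<le> norm ((s / \<epsilon>) *\<^sub>R g $ i)" for i
  proof -
    define r where "r = sqrt (m $ i)"
    have r: "0 \<le> r" "r \<le> s"
      using m[of i] \<open>s \<ge> 0\<close> by (auto simp: r_def intro: real_le_lsqrt)
    have "(g - \<epsilon> *\<^sub>R (inv_vec (\<epsilon> *\<^sub>R 1 + sqrt_vec m) * g)) $ i = r / (\<epsilon> + r) * g $ i"
      using r \<open>\<epsilon> > 0\<close> by (simp add: inv_vec_def sqrt_vec_def r_def[symmetric] field_simps)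
    moreover have "r / (\<epsilon> + r) \<le> s / \<epsilon>"
      using r \<open>\<epsilon> > 0\<close> by (intro frac_le) auto
    ultimately show ?thesis
      using r \<open>\<epsilon> > 0\<close> \<open>s \<ge> 0\<close> by (simp add: abs_mult mult_right_mono del: times_divide_eq_left)
  qed
  then have "norm (g - \<epsilon> *\<^sub>R (inv_vec (\<epsilon> *\<^sub>R 1 + sqrt_vec m) * g)) \<le> norm ((s / \<epsilon>) *\<^sub>R g)"
    by (intro norm_le_componentwise_cart) auto
  then show ?thesis using assms(1,4) by simp
qed

theorem corollary2p9:
  fixes \<epsilon> \<delta> \<kappa> K \<beta> :: real
    and L :: "real ^ 'd \<Rightarrow> real"
    and \<psi> :: "real ^ 'd"
    and M \<Theta> :: "real ^ 'd \<Rightarrow> nat \<Rightarrow> real ^ 'd"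
  assumes "\<epsilon> > 0" and "\<delta> > 0" and "\<kappa> > 0" and "K > \<kappa>"
    and "\<beta> \<in> {0..1}"
    and "C2 L"
    and "grad L \<psi> = 0"
    and "\<kappa> *\<^sub>R mat 1 \<preceq> Hess L \<psi>" and "Hess L \<psi> \<preceq> K *\<^sub>R mat 1"
    and "\<And>\<theta>. \<Theta> \<theta> 0 = \<theta>"
    and "\<And>\<theta>. M \<theta> 0 = 0"
    and "\<And>\<theta> n. n \<ge> 1 \<Longrightarrow>
           M \<theta> n = \<beta> *\<^sub>R M \<theta> (n - 1) + (1 - \<beta>) *\<^sub>R (grad L (\<Theta> \<theta> (n - 1)))\<^sup>2"
    and "\<And>\<theta> n. n \<ge> 1 \<Longrightarrow>
           \<Theta> \<theta> n = \<Theta> \<theta> (n - 1)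
             - (2 * \<epsilon> / (\<kappa> + K)) *\<^sub>R
                 (inv_vec (\<epsilon> *\<^sub>R 1 + sqrt_vec (M \<theta> n)) * grad L (\<Theta> \<theta> (n - 1)))"
  shows "\<exists>\<eta> c. \<eta> > 0 \<and> c > 0 \<and>
           (\<forall>\<theta>. norm (\<theta> - \<psi>) < \<eta> \<longrightarrow>
             (\<forall>n\<ge>1. norm (\<Theta> \<theta> n - \<psi>) \<le> c * ((K - \<kappa>) / (K + \<kappa>) + \<delta>) ^ n))"
proof -
  define H where "H = Hess L \<psi>"
  define a where "a = 2 / (\<kappa> + K)"
  define q where "q = (K - \<kappa>) / (K + \<kappa>)"
  \<comment> \<open>The cap gives \<rho> \<le> 1, and it is positive because \<open>q < 1\<close>.
    Half of \<delta>' is spent on the linearization error and half on the preconditioner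
    error.\<close>
  define \<delta>' where "\<delta>' = min \<delta> (1 - q)"
  define \<rho> where "\<rho> = q + \<delta>'"
  have a: "a > 0" using assms(3,4) by (simp add: a_def)
  have q: "0 < q" "q < 1" using assms(3,4) by (auto simp: q_def)
  have \<delta>': "\<delta>' > 0" "\<delta>' \<le> \<delta>" using q assms(2) by (auto simp: \<delta>'_def)
  have \<rho>: "0 < \<rho>" "\<rho> \<le> 1" "\<rho> \<le> q + \<delta>" using q \<delta>' by (auto simp: \<rho>_def \<delta>'_def)
  have gd: "GDERIV L y :> grad L y" for y
    using \<open>C2 L\<close> by (intro GDERIV_grad) (auto simp: C2_def differentiable_on_def)
  have "grad L differentiable (at \<psi>)"
    using \<open>C2 L\<close> by (auto simp: C2_def differentiable_on_def)
  then have hd: "(grad L has_derivative (\<lambda>h. H *v h)) (at \<psi>)"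
    unfolding H_def Hess_def using jacobian_works by blast
  have contr: "norm (v - a *\<^sub>R (H *v v)) \<le> q * norm v" for v
    unfolding a_def q_def H_def
    using gradient_derivative_symmetric[OF gd hd] assms(3,4,8,9)
    by (intro richardson_contraction) (auto simp: H_def)
  obtain B where B: "B > 0" "\<And>v. norm (H *v v) \<le> norm v * B"
    using bounded_linear.pos_bounded[OF matrix_vector_mul_bounded_linear[of H]] by blast
  \<comment> \<open>Chosen so that \<open>a * e = \<delta>' / 2\<close>.\<close>
  define e where "e = \<delta>' / (2 * a)"
  have e: "e > 0" using a \<delta>' by (simp add: e_def)
  \<comment> \<open>As the gradient vanishes at \<psi>, it grows at most like \<open>C\<close> times
    the distance to \<psi>: \<open>B\<close> accounts for the Hessian and \<open>e\<close> for the
    linearization error.\<close>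
  define C where "C = B + e"
  have C: "C > 0" using B e by (simp add: C_def)
  from hd e obtain d where d: "d > 0"
    and approx: "\<And>y. norm (y - \<psi>) < d \<Longrightarrow>
      norm (grad L y - H *v (y - \<psi>)) \<le> e * norm (y - \<psi>)"
    unfolding has_derivative_at_alt assms(7) by (metis diff_zero)
  \<comment> \<open>The first bound makes the linearization valid on the ball. The second makes the
    preconditioner error, with \<open>s = C * \<eta>\<close> and gradient growth \<open>C\<close>,
    at most \<delta>'/2 relative to the distance.\<close>
  define \<eta> where "\<eta> = min d (\<delta>' * \<epsilon> / (2 * a * C\<^sup>2))"
  have \<eta>: "\<eta> > 0" "\<eta> \<le> d" using d \<delta>' a C assms(1) by (auto simp: \<eta>_def)
  have "\<eta> \<le> \<delta>' * \<epsilon> / (2 * a * C\<^sup>2)" by (simp add: \<eta>_def)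
  then have \<eta>_small: "a * (C * \<eta> / \<epsilon> * C) \<le> \<delta>' / 2"
    using a C assms(1) by (simp add: field_simps power2_eq_square)
  have grad_le: "norm (grad L y) \<le> C * norm (y - \<psi>)" if "norm (y - \<psi>) < \<eta>" for y
  proof -
    have "norm (grad L y) \<le> norm (H *v (y - \<psi>)) + norm (grad L y - H *v (y - \<psi>))"
      using norm_triangle_ineq[of "H *v (y - \<psi>)" "grad L y - H *v (y - \<psi>)"] by simp
    also have "\<dots> \<le> norm (y - \<psi>) * B + e * norm (y - \<psi>)"
      using approx[of y] B(2)[of "y - \<psi>"] that \<eta> by (intro add_mono) auto
    finally show ?thesis by (simp add: C_def algebra_simps)
  qed
  have step: "norm (y - (2 * \<epsilon> / (\<kappa> + K)) *\<^sub>R (inv_vec (\<epsilon> *\<^sub>R 1 + sqrt_vec m) * grad L y) - \<psi>)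
      \<le> \<rho> * norm (y - \<psi>)"
    if y: "norm (y - \<psi>) < \<eta>" and m: "\<And>i. 0 \<le> m $ i" "\<And>i. m $ i \<le> (C * \<eta>)\<^sup>2" for y m
  proof -
    let ?x = "y - \<psi>" and ?g = "grad L y"
    let ?p = "\<epsilon> *\<^sub>R (inv_vec (\<epsilon> *\<^sub>R 1 + sqrt_vec m) * grad L y)"
    \<comment> \<open>The step splits into the exact step for the linearized gradient, the
      preconditioner error and the linearization error.\<close>
    have "y - (2 * \<epsilon> / (\<kappa> + K)) *\<^sub>R (inv_vec (\<epsilon> *\<^sub>R 1 + sqrt_vec m) * grad L y) - \<psi>
        = (?x - a *\<^sub>R (H *v ?x)) + (a *\<^sub>R (?g - ?p) - a *\<^sub>R (?g - H *v ?x))"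
      by (simp add: a_def algebra_simps)
    also have "norm \<dots> \<le> norm (?x - a *\<^sub>R (H *v ?x)) + (norm (a *\<^sub>R (?g - ?p)) + norm (a *\<^sub>R (?g - H *v ?x)))"
      by (intro norm_triangle_le add_mono order_refl norm_triangle_ineq4)
    also have "\<dots> \<le> q * norm ?x + (\<delta>' / 2 * norm ?x + \<delta>' / 2 * norm ?x)"
    proof (intro add_mono contr)
      have "norm (?g - ?p) \<le> C * \<eta> / \<epsilon> * norm ?g"
        using assms(1) m C \<eta> by (intro preconditioner_error) auto
      also have "\<dots> \<le> C * \<eta> / \<epsilon> * (C * norm ?x)"
        using grad_le[OF y] C \<eta> assms(1) by (intro mult_left_mono) auto
      finally have "a * norm (?g - ?p) \<le> a * (C * \<eta> / \<epsilon> * (C * norm ?x))"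
        using a by (intro mult_left_mono) auto
      also have "\<dots> = a * (C * \<eta> / \<epsilon> * C) * norm ?x" by simp
      also have "\<dots> \<le> \<delta>' / 2 * norm ?x" using \<eta>_small by (rule mult_right_mono) simp
      finally show "norm (a *\<^sub>R (?g - ?p)) \<le> \<delta>' / 2 * norm ?x" using a by simp
      have "a * norm (?g - H *v ?x) \<le> a * (e * norm ?x)"
        using approx[of y] y \<eta> a by (intro mult_left_mono) auto
      then show "norm (a *\<^sub>R (?g - H *v ?x)) \<le> \<delta>' / 2 * norm ?x"
        using a by (simp add: e_def)
    qed
    also have "\<dots> = \<rho> * norm ?x" by (simp add: \<rho>_def algebra_simps)
    finally show ?thesis .
  qed
  \<comment> \<open>Both claims go through one induction: the bound on the next \<open>M\<close>
    needs the current iterate in the ball, and the contraction of the next iterate needs that bound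
    on \<open>M\<close>.\<close>
  have main: "norm (\<Theta> \<theta> n - \<psi>) \<le> \<rho> ^ n * norm (\<theta> - \<psi>) \<and>
      (\<forall>i. 0 \<le> M \<theta> n $ i \<and> M \<theta> n $ i \<le> (C * \<eta>)\<^sup>2)"
    if \<theta>: "norm (\<theta> - \<psi>) < \<eta>" for \<theta> n
  proof (induction n)
    case 0
    then show ?case by (simp add: assms(10,11))
  next
    case (Suc n)
    \<comment> \<open>Here \<rho> \<le> 1 keeps the iterate in the initial ball.\<close>
    have "\<rho> ^ n * norm (\<theta> - \<psi>) \<le> norm (\<theta> - \<psi>)"
      using \<rho> by (intro mult_left_le_one_le power_le_one) auto
    with Suc \<theta> have near: "norm (\<Theta> \<theta> n - \<psi>) < \<eta>" by linarith
    have M: "0 \<le> M \<theta> (Suc n) $ i \<and> M \<theta> (Suc n) $ i \<le> (C * \<eta>)\<^sup>2" for i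
    proof -
      have "\<bar>grad L (\<Theta> \<theta> n) $ i\<bar> \<le> C * norm (\<Theta> \<theta> n - \<psi>)"
        using component_le_norm_cart[of "grad L (\<Theta> \<theta> n)" i] grad_le[OF near] by linarith
      also have "\<dots> \<le> C * \<eta>" using near C by simp
      finally have g: "(grad L (\<Theta> \<theta> n) $ i)\<^sup>2 \<le> (C * \<eta>)\<^sup>2"
        using abs_le_square_iff C \<eta> by force
      have "M \<theta> (Suc n) $ i = \<beta> * M \<theta> n $ i + (1 - \<beta>) * (grad L (\<Theta> \<theta> n) $ i)\<^sup>2"
        by (simp add: assms(12) vec_power_nth)
      \<comment> \<open>\<open>M\<close> is updated by a convex combination, and both of its terms
        lie between 0 and \<open>(C * \<eta>)\<^sup>2\<close>.\<close>
      then show ?thesis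
        using Suc g assms(5) convex_bound_le[of "M \<theta> n $ i" "(C * \<eta>)\<^sup>2" "(grad L (\<Theta> \<theta> n) $ i)\<^sup>2" \<beta> "1 - \<beta>"]
        by simp
    qed
    have "norm (\<Theta> \<theta> (Suc n) - \<psi>) \<le> \<rho> * norm (\<Theta> \<theta> n - \<psi>)"
      using step[OF near] M assms(13)[of "Suc n" \<theta>] by simp
    also have "\<dots> \<le> \<rho> * (\<rho> ^ n * norm (\<theta> - \<psi>))"
      using Suc \<rho> by (intro mult_left_mono) auto
    finally show ?case using M by (simp add: mult.assoc)
  qed
  \<comment> \<open>The radius \<eta> itself serves as the constant \<open>c\<close>, and the capped
    rate \<rho> is relaxed to \<open>q + \<delta>\<close>.\<close>
  have "norm (\<Theta> \<theta> n - \<psi>) \<le> \<eta> * (q + \<delta>) ^ n" if "norm (\<theta> - \<psi>) < \<eta>" for \<theta> n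
  proof -
    have "norm (\<Theta> \<theta> n - \<psi>) \<le> \<rho> ^ n * norm (\<theta> - \<psi>)" using main[OF that] by blast
    also have "\<dots> \<le> (q + \<delta>) ^ n * \<eta>"
      using that \<rho> by (intro mult_mono power_mono) auto
    finally show ?thesis by (simp add: mult.commute)
  qed
  then show ?thesis using \<eta>(1) unfolding q_def by blast
qed

end
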